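(* Let $m\ge1$, $n=2m$, $q=2^m$, let $\omega$ be a primitive element of $\mathbb{F}_{q^2}$ and $u=\omega^{(q-1)(2^{n-1}-1)}$ (a generator of $\mu_{q+1}$). Let $a_i\in\mathbb{F}_{q^2}$, integers $0\le s_i\le q$, and $\alpha_i=a_iu^{(1-2s_i)i}+a_i^qu^{(2s_i-1)i}$ for $i\in\mathbb{Z}_{q+1}$. Define $f(0)=0$ and $f(x)={\rm Tr}_1^n(a_ix^{s_i(q-1)+1})$ if $x\in u^i\mathbb{F}_q^*$, $i\in\mathbb{Z}_{q+1}$. Then $f$ is bent if and only if one of the following holds: (1) $\alpha_i\ne0$ for all $i\in\mathbb{Z}_{q+1}$, and for every $t\in\mathbb{Z}_{q+1}$, each element of the multiset $\{\{\alpha_i/(u^i+u^{2t-i}) : i\in\mathbb{Z}_{q+1}\setminus\{t\}\}\}$ has multiplicity $2$; (2) there are two distinct $i_1,i_2\in\mathbb{Z}_{q+1}$ with $\alpha_{i_1}=\alpha_{i_2}=0$ and $\alpha_i\ne0$ for all $i\in\mathbb{Z}_{q+1}\setminus\{i_1,i_2\}$; for $t\in\{i_1,i_2\}$ the elements $\alpha_i/(u^i+u^{2t-i})$, $i\in\mathbb{Z}_{q+1}\setminus\{i_1,i_2\}$, are pairwise distinct; and for every $t\in\mathbb{Z}_{q+1}\setminus\{i_1,i_2\}$, each element of the multiset $\{\{\alpha_i/(u^i+u^{2t-i}): i\in\mathbb{Z}_{q+1}\setminus\{t,i_1,i_2\}\}\}$ has multiplicity $2$.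
   Context: ${\rm Tr}_1^k$ is the absolute trace of $\mathbb{F}_{2^k}$, $\mu_e=\{x:x^e=1\}$. Walsh transform $\widehat f(b)=\sum_x(-1)^{f(x)+{\rm Tr}_1^n(bx)}$; $f$ is bent iff $|\widehat f(b)|=2^{n/2}$ for all $b$. *)

theory Defs
  imports
    Complex_Main
    "HOL-Library.Multiset"
    "HOL-Library.Z2"
    "HOL-Library.Cardinality"
    "HOL-Computational_Algebra.Primes"
    "HOL-Number_Theory.Residues"
begin

text \<open>
  The field \<open>GF(2^n)\<close> is a type \<open>'a :: finite_field\<close> with \<open>CARD('a) = 2 ^ n\<close>, and \<open>GF(2)\<close> is the
  type \<open>bit\<close>, embedded into \<open>'a\<close> by \<open>of_bit\<close>.
\<close>

text \<open>
  The trace is the element of \<open>GF(2)\<close> whose image in \<open>'a\<close> is \<open>x + x^2 + x^4 + ... + x^(2^(k-1))\<close>.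
  The lemma \<open>of_bit_abs_trace\<close> shows that it exists when \<open>CARD('a) = 2 ^ k\<close>.
\<close>
definition abs_trace :: "nat \<Rightarrow> 'a :: finite_field \<Rightarrow> bit" where
  "abs_trace k x = (THE c. of_bit c = (\<Sum>j<k. x ^ (2 ^ j)))"

definition walsh :: "nat \<Rightarrow> ('a :: finite_field \<Rightarrow> bit) \<Rightarrow> 'a \<Rightarrow> int" where
  "walsh n f b = (\<Sum>x\<in>UNIV. (-1) ^ (of_bit (f x + abs_trace n (b * x)) :: nat))"

definition bent :: "nat \<Rightarrow> ('a :: finite_field \<Rightarrow> bit) \<Rightarrow> bool" where
  "bent n f \<longleftrightarrow> (\<forall>b. \<bar>real_of_int (walsh n f b)\<bar> = 2 powr (real n / 2))"

definition primitive_element :: "'a :: finite_field \<Rightarrow> bool" where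
  "primitive_element w \<longleftrightarrow> range (\<lambda>k::nat. w ^ k) = UNIV - {0}"

text \<open>The subfield with \<open>q\<close> elements, when \<open>CARD('a)\<close> is a power of \<open>q\<close>.\<close>
definition subfield_of_order :: "nat \<Rightarrow> 'a :: finite_field set" where
  "subfield_of_order q = {x. x ^ q = x}"

lemma of_bit_abs_trace:
  fixes x :: "'a :: finite_field"
  assumes card: "CARD('a) = 2 ^ k"
  shows "of_bit (abs_trace k x) = (\<Sum>j<k. x ^ (2 ^ j))"
proof -
  let ?T = "\<Sum>j<k. x ^ (2 ^ j)"
  have "CHAR('a) dvd 2 ^ k" using CHAR_dvd_CARD[where 'a = 'a] card by simp
  moreover have "prime CHAR('a)" by (rule prime_CHAR_semidom) (rule CHAR_pos)
  ultimately have char: "CHAR('a) = 2"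
    using prime_dvd_power primes_dvd_imp_eq two_is_prime_nat by blast
  have "?T ^ 2 = (\<Sum>j<k. (x ^ (2 ^ j)) ^ 2)"
    using freshmans_dream_sum[where 'a = 'a and f = "\<lambda>j. x ^ (2 ^ j)" and A = "{..<k}"] char by simp
  also have "\<dots> = (\<Sum>j<k. x ^ (2 ^ Suc j))"
    by (simp add: power_mult[symmetric] mult.commute)
  also have "\<dots> = ?T - x + x ^ (2 ^ k)"
    using sum.lessThan_Suc_shift[of "\<lambda>j. x ^ (2 ^ j)" k] sum.lessThan_Suc[of "\<lambda>j. x ^ (2 ^ j)" k]
    by (simp add: algebra_simps)
  also have "x ^ (2 ^ k) = x"
    using finite_field_power_card_eq_same[of x] card by simp
  finally have "?T * (?T - 1) = 0" by (simp add: power2_eq_square algebra_simps)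
  hence "?T = 0 \<or> ?T = 1" by auto
  hence "\<exists>!c. of_bit c = ?T"
  proof
    assume T: "?T = 0"
    show ?thesis unfolding T by (rule ex1I[of _ 0]) (auto simp: of_bool_def split: if_splits)
  next
    assume T: "?T = 1"
    show ?thesis unfolding T by (rule ex1I[of _ 1]) (auto simp: of_bool_def split: if_splits)
  qed
  thus ?thesis unfolding abs_trace_def by (rule theI')
qed

end

theory Submission
  imports Defs "HOL-Computational_Algebra.Polynomial"
begin

text \<open>
  Write \<open>K\<close> for the subfield of order \<open>q\<close>. Every nonzero element is uniquely \<open>u^i y\<close> with
  \<open>0 \<le> i \<le> q\<close> and \<open>y \<in> K - {0}\<close>, and on the ray \<open>u^i K\<close> both \<open>f(x)\<close> and \<open>Tr(b x)\<close> are linear in \<open>y\<close>.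
  Summing the sign character over each ray gives \<open>W(b) = q (N(b) - 1)\<close>, where \<open>N(b)\<close> counts the
  \<open>i\<close> with \<open>\<alpha>_i = b u^i + b^q u^(-i)\<close>; hence \<open>f\<close> is bent iff \<open>N(b) \<in> {0, 2}\<close> for all \<open>b\<close>.
  At \<open>b = 0\<close> this says that \<open>\<alpha>\<close> has no zero or exactly two. A nonzero \<open>b\<close> lies in
  \<open>u^(-t) K\<close> for some \<open>t\<close>, and then \<open>b^q = b u^(2t)\<close>, so that for \<open>i \<noteq> t\<close> the equation reads
  \<open>\<alpha>_i / (u^i + u^(2t-i)) = b\<close>, whereas for \<open>i = t\<close> it reads \<open>\<alpha>_t = 0\<close>.
\<close>

section \<open>Characteristic two, signs and the absolute trace\<close>

lemma CHAR_eq_2: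
  assumes "CARD('a :: finite_field) = 2 ^ k"
  shows "CHAR('a) = 2"
proof -
  have "CHAR('a) dvd 2 ^ k" using CHAR_dvd_CARD[where 'a = 'a] assms by simp
  moreover have "prime CHAR('a)" by (rule prime_CHAR_semidom) (rule CHAR_pos)
  ultimately show ?thesis
    using prime_dvd_power primes_dvd_imp_eq two_is_prime_nat by blast
qed

text \<open>The sign in the summand of \<open>walsh\<close>, named so that its multiplicativity can
  be used.\<close>

definition bit_sign :: "bit \<Rightarrow> int" where
  "bit_sign c = (-1) ^ (of_bit c :: nat)"

lemma bit_sign_simps [simp]: "bit_sign 0 = 1" "bit_sign 1 = -1"
  by (simp_all add: bit_sign_def)

lemma bit_sign_add: "bit_sign (c + d) = bit_sign c * bit_sign d"
  by (cases c; cases d) simp_all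

text \<open>Frobenius powers are additive in characteristic 2, and \<open>of_bit\<close> is an
  injective homomorphism there, so the identity can be checked inside the field.\<close>

lemma abs_trace_add:
  fixes x y :: "'a :: finite_field"
  assumes card: "CARD('a) = 2 ^ k"
  shows "abs_trace k (x + y) = abs_trace k x + abs_trace k y"
proof -
  have ch: "CHAR('a) = 2" by (rule CHAR_eq_2[OF card])
  have two: "(1 + 1 :: 'a) = 0"
    using of_nat_CHAR[where 'a = 'a] ch by simp
  have "of_bit (abs_trace k (x + y)) = (\<Sum>j<k. (x + y) ^ 2 ^ j)"
    by (rule of_bit_abs_trace[OF card])
  also have "\<dots> = (\<Sum>j<k. x ^ 2 ^ j) + (\<Sum>j<k. y ^ 2 ^ j)"
    by (simp add: freshmans_dream'[where 'a = 'a] ch sum.distrib)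
  also have "\<dots> = (of_bit (abs_trace k x) + of_bit (abs_trace k y) :: 'a)"
    by (simp only: of_bit_abs_trace[OF card])
  also have "\<dots> = of_bit (abs_trace k x + abs_trace k y)"
    using two by (cases "abs_trace k x"; cases "abs_trace k y") simp_all
  finally have "(of_bit (abs_trace k (x + y)) :: 'a) = of_bit (abs_trace k x + abs_trace k y)" .
  thus ?thesis
    by (cases "abs_trace k (x + y)"; cases "abs_trace k x + abs_trace k y") simp_all
qed

lemma abs_trace_0:
  assumes "CARD('a :: finite_field) = 2 ^ k"
  shows "abs_trace k (0 :: 'a) = 0"
  using abs_trace_add[OF assms, of 0 0] by (cases "abs_trace k (0 :: 'a)") simp_all

text \<open>The trace polynomial has degree at most \<open>2 ^ (m - 1)\<close>, too few roots to
  cover \<open>2 ^ m\<close> points. With a bare set \<open>S\<close>, this applies to the subfield,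
  which is not a type of its own.\<close>

lemma exists_trace_nonzero:
  fixes S :: "'a :: finite_field set"
  assumes m: "m \<ge> 1" and S: "card S = 2 ^ m"
  shows "\<exists>z\<in>S. (\<Sum>j<m. z ^ 2 ^ j) \<noteq> 0"
proof (rule ccontr)
  assume "\<not> ?thesis"
  hence all: "\<And>z. z \<in> S \<Longrightarrow> (\<Sum>j<m. z ^ 2 ^ j) = 0" by blast
  define p :: "'a poly" where "p = (\<Sum>j<m. monom 1 (2 ^ j))"
  have poly_p: "poly p z = (\<Sum>j<m. z ^ 2 ^ j)" for z
    by (simp add: p_def poly_sum poly_monom)
  \<comment> \<open>Only \<open>j = 0\<close> yields the exponent 1, and \<open>m \<ge> 1\<close>
    ensures that this index occurs.\<close>
  have "coeff p (2 ^ 0) = (\<Sum>j<m. if j = 0 then 1 else 0)"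
    unfolding p_def coeff_sum coeff_monom by (intro sum.cong) auto
  hence "p \<noteq> 0" using m by auto
  have deg: "degree p \<le> 2 ^ (m - 1)"
    unfolding p_def by (intro degree_sum_le) (auto intro!: order.trans[OF degree_monom_le] power_increasing)
  have "card S \<le> card {z. poly p z = 0}"
    by (intro card_mono poly_roots_finite \<open>p \<noteq> 0\<close>) (auto simp: poly_p all)
  also have "\<dots> \<le> degree p" by (rule card_poly_roots_bound[OF \<open>p \<noteq> 0\<close>])
  also note deg
  also have "(2::nat) ^ (m - 1) < 2 ^ m" using m by simp
  finally show False using S by simp
qed

text \<open>Translates multiplicities in the multisets of the theorem into sizes of fibres, the form
  in which solutions are counted.\<close>

lemma image_mset_count_iff:
  assumes "finite S"
  shows "(\<forall>z\<in>#image_mset g (mset_set S). count (image_mset g (mset_set S)) z = k) \<longleftrightarrow>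
    (\<forall>z\<in>g ` S. card {i \<in> S. g i = z} = k)"
proof -
  have "count (image_mset g (mset_set S)) z = card {i \<in> S. g i = z}" for z
  proof -
    have "count (image_mset g (mset_set S)) z = (\<Sum>i | i \<in> S \<and> z = g i. count (mset_set S) i)"
      using assms by (simp add: count_image_mset')
    also have "\<dots> = (\<Sum>i | i \<in> S \<and> z = g i. 1)"
      by (intro sum.cong) (simp_all add: assms)
    also have "\<dots> = card {i \<in> S. g i = z}" by (simp add: eq_commute)
    finally show ?thesis .
  qed
  thus ?thesis using assms by simp
qed

section \<open>The field of order q^2 and the conjugation x -> x^q\<close>

locale even_degree_field =
  fixes m q :: nat and \<omega> u :: "'a :: finite_field"
  assumes m: "m \<ge> 1" and q: "q = 2 ^ m" and card: "CARD('a) = q ^ 2"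
    and \<omega>: "primitive_element \<omega>"
    and u: "u = \<omega> ^ ((q - 1) * (2 ^ (2 * m - 1) - 1))"
begin

abbreviation K :: "'a set" where "K \<equiv> subfield_of_order q"

lemma card_2: "CARD('a) = 2 ^ (2 * m)"
  using card q by (simp add: power_mult mult.commute)

lemma CHAR_2: "CHAR('a) = 2"
  by (rule CHAR_eq_2[OF card_2])

lemma add_self [simp]: "x + x = (0 :: 'a)"
proof -
  have "(1 + 1 :: 'a) = 0" using of_nat_CHAR[where 'a = 'a] CHAR_2 by simp
  hence "(1 + 1) * x = 0" by simp
  thus ?thesis by (simp only: distrib_right mult_1)
qed

lemma add_eq_0_iff_eq: "x + y = 0 \<longleftrightarrow> x = (y :: 'a)"
  by (metis add_self add_left_cancel)

lemma q_gt_1: "q > 1"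
  using one_less_power[of "2::nat" m] m q by linarith

lemma conj_add: "(x + y) ^ q = x ^ q + (y :: 'a) ^ q"
  by (rule freshmans_dream'[of _ m]) (simp_all add: CHAR_2 q)

lemma conj_conj: "(x ^ q) ^ q = (x :: 'a)"
  using finite_field_power_card_eq_same[of x] card by (simp add: power2_eq_square power_mult)

lemma in_K_iff: "x \<in> K \<longleftrightarrow> x ^ q = x"
  by (simp add: subfield_of_order_def)

lemma K_0: "0 \<in> K"
  using q_gt_1 by (simp add: in_K_iff)

lemma K_divide: "x \<in> K \<Longrightarrow> y \<in> K \<Longrightarrow> x / y \<in> K"
  by (simp add: in_K_iff power_divide)

lemma K_add: "x \<in> K \<Longrightarrow> y \<in> K \<Longrightarrow> x + y \<in> K"
  by (simp add: in_K_iff conj_add)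

lemma K_trace: "x + x ^ q \<in> K"
  by (simp add: in_K_iff conj_add conj_conj add.commute)

section \<open>Powers of the primitive element and the size of the subfield\<close>

lemma \<omega>_nonzero: "\<omega> \<noteq> 0"
proof
  assume "\<omega> = 0"
  moreover have "\<omega> ^ 1 \<in> UNIV - {0}"
    using \<omega> unfolding primitive_element_def by blast
  ultimately show False by simp
qed

lemma \<omega>_power_order: "\<omega> ^ (q\<^sup>2 - 1) = 1"
proof -
  have "q\<^sup>2 = Suc (q\<^sup>2 - 1)" using q_gt_1 by simp
  hence "\<omega> * \<omega> ^ (q\<^sup>2 - 1) = \<omega>"
    using finite_field_power_card_eq_same[of \<omega>] card by (metis power_Suc)
  thus ?thesis using \<omega>_nonzero by simp
qed

lemma \<omega>_power_mod: "\<omega> ^ (k mod (q\<^sup>2 - 1)) = \<omega> ^ k"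
proof -
  have "\<omega> ^ k = \<omega> ^ ((q\<^sup>2 - 1) * (k div (q\<^sup>2 - 1)) + k mod (q\<^sup>2 - 1))"
    by simp
  also have "\<dots> = \<omega> ^ (k mod (q\<^sup>2 - 1))"
    by (simp only: power_add power_mult \<omega>_power_order power_one mult_1)
  finally show ?thesis by simp
qed

lemma q2_minus_1_pos: "q\<^sup>2 - 1 > 0"
  using one_less_power[of q 2] q_gt_1 by linarith

lemma \<omega>_image: "(\<lambda>k. \<omega> ^ k) ` {..<q\<^sup>2 - 1} = UNIV - {0}"
proof -
  have "range (\<lambda>k. \<omega> ^ k) \<subseteq> (\<lambda>k. \<omega> ^ k) ` {..<q\<^sup>2 - 1}"
  proof safe
    fix k show "\<omega> ^ k \<in> (\<lambda>k. \<omega> ^ k) ` {..<q\<^sup>2 - 1}"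
      using q2_minus_1_pos
      by (intro image_eqI[of _ _ "k mod (q\<^sup>2 - 1)"]) (simp_all only: \<omega>_power_mod mod_less_divisor lessThan_iff)
  qed
  hence "(\<lambda>k. \<omega> ^ k) ` {..<q\<^sup>2 - 1} = range (\<lambda>k. \<omega> ^ k)"
    by (rule subset_antisym[OF image_mono[OF subset_UNIV]])
  thus ?thesis using \<omega> unfolding primitive_element_def by (rule trans)
qed

text \<open>There are as many exponents as nonzero elements, q^2 - 1, so a surjection cannot
  identify two of them.\<close>

lemma \<omega>_inj: "inj_on (\<lambda>k. \<omega> ^ k) {..<q\<^sup>2 - 1}"
proof (rule eq_card_imp_inj_on)
  show "card ((\<lambda>k. \<omega> ^ k) ` {..<q\<^sup>2 - 1}) = card {..<q\<^sup>2 - 1}"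
    unfolding \<omega>_image by (simp add: card_Diff_singleton card)
qed simp

lemma \<omega>_power_eq_1_iff: "\<omega> ^ k = 1 \<longleftrightarrow> (q\<^sup>2 - 1) dvd k"
proof
  assume "\<omega> ^ k = 1"
  hence "\<omega> ^ (k mod (q\<^sup>2 - 1)) = \<omega> ^ 0" by (simp only: \<omega>_power_mod power_0)
  hence "k mod (q\<^sup>2 - 1) = 0"
    using q2_minus_1_pos by (intro inj_onD[OF \<omega>_inj]) simp_all
  thus "(q\<^sup>2 - 1) dvd k" by (simp add: dvd_eq_mod_eq_0)
next
  assume "(q\<^sup>2 - 1) dvd k"
  then obtain j where "k = (q\<^sup>2 - 1) * j" by (auto simp only: dvd_def)
  thus "\<omega> ^ k = 1" by (simp only: power_mult \<omega>_power_order power_one)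
qed

lemma q2_minus_1: "q\<^sup>2 - 1 = (q - 1) * (q + 1)"
  by (simp add: power2_eq_square algebra_simps)

text \<open>The condition x^(q-1) = 1 forces the exponent of \<open>\<omega>\<close> to be a
  multiple of q + 1, so \<open>K - {0}\<close> is the cyclic group generated by
  \<open>\<omega> ^ (q + 1)\<close>.\<close>

lemma card_K: "card K = q"
proof -
  have "K - {0} = (\<lambda>j. \<omega> ^ ((q + 1) * j)) ` {..<q - 1}"
  proof (intro equalityI subsetI)
    fix x assume x: "x \<in> K - {0}"
    then obtain k where k: "x = \<omega> ^ k" "k < q\<^sup>2 - 1" using \<omega>_image by blast
    have "x ^ Suc (q - 1) = x" using x q_gt_1 by (simp add: in_K_iff)
    hence "x ^ (q - 1) = 1" using x by simp
    hence "\<omega> ^ (k * (q - 1)) = 1" by (simp only: power_mult k(1)[symmetric])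
    hence "(q - 1) * (q + 1) dvd (q - 1) * k"
      by (simp only: \<omega>_power_eq_1_iff q2_minus_1 mult.commute[of k])
    hence "q + 1 dvd k" using q_gt_1 by (simp only: nat_mult_dvd_cancel_disj) simp
    then obtain j where j: "k = (q + 1) * j" by (auto simp: dvd_def)
    have "(q + 1) * j < (q + 1) * (q - 1)" using k(2) unfolding j q2_minus_1 by (simp only: mult.commute)
    hence "j < q - 1" by (simp only: mult_less_cancel1)
    thus "x \<in> (\<lambda>j. \<omega> ^ ((q + 1) * j)) ` {..<q - 1}" using k j by auto
  next
    fix x assume "x \<in> (\<lambda>j. \<omega> ^ ((q + 1) * j)) ` {..<q - 1}"
    then obtain j where x: "x = \<omega> ^ ((q + 1) * j)" by blast
    \<comment> \<open>Since q(q + 1) = (q^2 - 1) + (q + 1), conjugation changes the exponent by a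
      multiple of the order of \<open>\<omega>\<close>.\<close>
    have eq: "(q + 1) * j * q = (q\<^sup>2 - 1) * j + (q + 1) * j"
      unfolding q2_minus_1 using q_gt_1 by (cases q) (simp_all add: algebra_simps)
    have "x ^ q = \<omega> ^ ((q + 1) * j * q)" unfolding x by (rule power_mult[symmetric])
    also have "\<dots> = (\<omega> ^ (q\<^sup>2 - 1)) ^ j * x"
      unfolding eq x power_add by (simp only: power_mult)
    finally have "x ^ q = (\<omega> ^ (q\<^sup>2 - 1)) ^ j * x" .
    hence "x ^ q = x" by (simp only: \<omega>_power_order power_one mult_1)
    thus "x \<in> K - {0}" using x \<omega>_nonzero by (simp add: in_K_iff)
  qed
  moreover have "inj_on (\<lambda>j. \<omega> ^ ((q + 1) * j)) {..<q - 1}"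
  proof (rule inj_onI)
    fix i j assume ij: "i \<in> {..<q - 1}" "j \<in> {..<q - 1}" "\<omega> ^ ((q + 1) * i) = \<omega> ^ ((q + 1) * j)"
    have "(q + 1) * k < q\<^sup>2 - 1" if "k < q - 1" for k
      unfolding q2_minus_1 mult.commute[of "q - 1"] using that by (simp only: mult_less_cancel1) simp
    hence "(q + 1) * i < q\<^sup>2 - 1" "(q + 1) * j < q\<^sup>2 - 1" using ij(1,2) by blast+
    hence "(q + 1) * i = (q + 1) * j" using inj_onD[OF \<omega>_inj ij(3)] by blast
    thus "i = j" by (simp only: mult_cancel1) simp
  qed
  ultimately have "card (K - {0}) = q - 1" by (simp add: card_image)
  thus ?thesis using K_0 q_gt_1 by (simp add: card_Diff_singleton)
qed

section \<open>The generator \<open>u\<close> of the group of order q + 1\<close>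

lemma u_nonzero: "u \<noteq> 0"
  using \<omega>_nonzero by (simp add: u)

text \<open>The element \<open>\<omega> ^ (q - 1)\<close> has order q + 1, and raising it to the
  power \<open>e\<close> keeps this order: q + 1 divides q^2 - 1 = 2e + 1, so it is coprime to
  \<open>e\<close>.\<close>

lemma u_power_eq_1_iff: "u ^ k = 1 \<longleftrightarrow> (q + 1) dvd k"
proof -
  define e :: nat where "e = 2 ^ (2 * m - 1) - 1"
  have "2 * (e + 1) = q\<^sup>2"
    using m by (simp add: e_def q mult.commute flip: power_mult power_Suc)
  hence eq: "2 * e + 1 = (q + 1) * (q - 1)" using q2_minus_1 by (simp add: mult.commute)
  have cop: "coprime (q + 1) e"
  proof (rule coprimeI)
    fix d assume d: "d dvd q + 1" "d dvd e"
    have "d dvd 2 * e + 1" unfolding eq using d(1) by (rule dvd_mult2)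
    moreover have "d dvd 2 * e" using d(2) by (rule dvd_mult)
    ultimately show "is_unit d" by (simp only: dvd_add_right_iff)
  qed
  have "u ^ k = 1 \<longleftrightarrow> (q - 1) * (q + 1) dvd (q - 1) * (e * k)"
    unfolding u e_def[symmetric] power_mult[symmetric] \<omega>_power_eq_1_iff q2_minus_1 mult.assoc ..
  also have "\<dots> \<longleftrightarrow> q + 1 dvd e * k" using q_gt_1 by (simp only: nat_mult_dvd_cancel_disj) simp
  also have "\<dots> \<longleftrightarrow> q + 1 dvd k" by (rule coprime_dvd_mult_right_iff[OF cop])
  finally show ?thesis .
qed

lemma u_powi_eq_1_iff: "u powi k = 1 \<longleftrightarrow> int (q + 1) dvd k"
proof (cases k rule: int_cases2)
  case (nonneg j)
  thus ?thesis by (simp only: power_int_of_nat u_power_eq_1_iff int_dvd_int_iff)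
next
  case (nonpos j)
  thus ?thesis
    by (simp only: power_int_minus inverse_eq_1_iff power_int_of_nat u_power_eq_1_iff int_dvd_int_iff
        dvd_minus_iff)
qed

lemma u_powi_add: "u powi (k + l) = u powi k * u powi l"
  by (simp add: power_int_add u_nonzero)

lemma u_powi_eqI: "int (q + 1) dvd k - l \<Longrightarrow> u powi k = u powi l"
  using u_powi_add[of "k - l" l] by (simp only: u_powi_eq_1_iff[symmetric]) simp

text \<open>Since q is -1 modulo q + 1, conjugation inverts the powers of \<open>u\<close>.\<close>

lemma u_powi_conj: "(u powi k) ^ q = u powi (- k)"
proof -
  have "(u powi k) ^ q = u powi (k * int q)" by (rule power_int_power')
  also have "\<dots> = u powi (- k)" by (rule u_powi_eqI) (auto simp: dvd_def algebra_simps)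
  finally show ?thesis .
qed

text \<open>As q + 1 is odd, 2 is invertible modulo q + 1. This separates distinct rays and keeps
  the denominators nonzero.\<close>

lemma u_powi_double_eq_1_iff: "u powi (2 * k) = 1 \<longleftrightarrow> int (q + 1) dvd k"
proof -
  have "even q" using m q by simp
  hence "coprime (int (q + 1)) 2" by (simp add: coprime_right_2_iff_odd)
  thus ?thesis by (simp only: u_powi_eq_1_iff coprime_dvd_mult_right_iff)
qed

text \<open>The difference is too small to be a nonzero multiple of q + 1; thus the naturals up to
  \<open>q\<close> can stand for the residues modulo q + 1.\<close>

lemma index_eq_iff:
  assumes "i \<le> q" "j \<le> q"
  shows "int (q + 1) dvd int i - int j \<longleftrightarrow> i = j"
proof
  assume "int (q + 1) dvd int i - int j"
  moreover have "\<bar>int i - int j\<bar> < int (q + 1)" using assms by auto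
  ultimately have "int i - int j = 0" 
    using dvd_imp_le_int[of "int i - int j" "int (q + 1)"] by linarith
  thus "i = j" by simp
qed simp

section \<open>Polar decomposition of the nonzero elements\<close>

definition polar :: "nat \<times> 'a \<Rightarrow> 'a" where
  "polar = (\<lambda>(i, y). u ^ i * y)"

text \<open>Conjugation inverts \<open>u ^ i\<close> and fixes \<open>y\<close>, which gives
  injectivity; surjectivity follows from (q + 1)(q - 1) = q^2 - 1.\<close>

lemma polar_bij: "bij_betw polar ({..q} \<times> (K - {0})) (UNIV - {0})"
proof -
  have inj: "inj_on polar ({..q} \<times> (K - {0}))"
  proof (rule inj_onI)
    fix v w assume "v \<in> {..q} \<times> (K - {0})" "w \<in> {..q} \<times> (K - {0})" "polar v = polar w"
    moreover obtain i y where v: "v = (i, y)" by (cases v)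
    moreover obtain j z where w: "w = (j, z)" by (cases w)
    ultimately have ij: "i \<le> q" "j \<le> q" and y: "y \<in> K" "y \<noteq> 0" and z: "z \<in> K" "z \<noteq> 0"
      and eq: "u ^ i * y = u ^ j * z"
      by (simp_all add: polar_def)
    have c: "(u ^ k) ^ q = u powi (- int k)" for k
      using u_powi_conj[of "int k"] by simp
    have "u powi (- int i) * y = u powi (- int j) * z"
      using arg_cong[OF eq, of "\<lambda>x. x ^ q"] y z by (simp add: power_mult_distrib c in_K_iff)
    \<comment> \<open>Crossing the equation with its conjugate puts \<open>y * z\<close> on both
      sides; cancelling it leaves a relation between powers of \<open>u\<close> alone.\<close>
    hence "(u ^ i * y) * (u powi (- int j) * z) = (u ^ j * z) * (u powi (- int i) * y)"
      using eq by simp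
    hence "u ^ i * u powi (- int j) = u ^ j * u powi (- int i)" using y z by simp
    hence "u powi (int i - int j) = u powi (int j - int i)"
      by (metis u_powi_add power_int_of_nat diff_conv_add_uminus)
    hence "u powi (int i - int j) * u powi (int i - int j)
        = u powi (int j - int i) * u powi (int i - int j)" by simp
    also have "\<dots> = 1" by (simp flip: u_powi_add)
    finally have "u powi (2 * (int i - int j)) = 1" by (simp only: mult_2 u_powi_add)
    hence "i = j" using ij by (simp only: u_powi_double_eq_1_iff index_eq_iff)
    thus "v = w" using eq u_nonzero v w by simp
  qed
  have "card (polar ` ({..q} \<times> (K - {0}))) = (q + 1) * (q - 1)"
    using inj K_0 by (simp add: card_image card_cartesian_product card_Diff_singleton card_K)
  also have "\<dots> = card (UNIV - {0 :: 'a})"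
    using q2_minus_1 by (simp add: card_Diff_singleton card mult.commute)
  finally have "card (polar ` ({..q} \<times> (K - {0}))) = card (UNIV - {0 :: 'a})" .
  moreover have "polar ` ({..q} \<times> (K - {0})) \<subseteq> UNIV - {0}"
    using u_nonzero by (auto simp: polar_def)
  ultimately have "polar ` ({..q} \<times> (K - {0})) = UNIV - {0}"
    by (intro card_subset_eq) simp_all
  thus ?thesis using inj by (simp add: bij_betw_def)
qed

section \<open>The trace and its character sums on the subfield\<close>

lemma sum_lessThan_add: "(\<Sum>j<k + l. g j) = (\<Sum>j<k. g j) + (\<Sum>j<l. g (k + j))"
  for g :: "nat \<Rightarrow> 'b :: comm_monoid_add"
  by (induction l) (simp_all add: add.assoc)

text \<open>Transitivity of the trace: the upper half of the sum is the lower half for the conjugate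
  of \<open>x * y\<close>, and \<open>y\<close> is fixed by conjugation, so \<open>x * y\<close> has
  relative trace \<open>(x + x ^ q) * y\<close>.\<close>

lemma trace_on_K:
  assumes "y \<in> K"
  shows "of_bit (abs_trace (2 * m) (x * y)) = (\<Sum>j<m. ((x + x ^ q) * y) ^ 2 ^ j)"
proof -
  have "of_bit (abs_trace (2 * m) (x * y)) = (\<Sum>j<m + m. (x * y) ^ 2 ^ j)"
    using of_bit_abs_trace[OF card_2, of "x * y"] by (simp only: mult_2)
  also have "\<dots> = (\<Sum>j<m. (x * y) ^ 2 ^ j) + (\<Sum>j<m. ((x * y) ^ q) ^ 2 ^ j)"
    by (simp add: sum_lessThan_add q power_add power_mult)
  also have "(x * y) ^ q = x ^ q * y"
    using assms by (simp add: power_mult_distrib in_K_iff)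
  also have "(\<Sum>j<m. (x * y) ^ 2 ^ j) + (\<Sum>j<m. (x ^ q * y) ^ 2 ^ j)
      = (\<Sum>j<m. (x * y + x ^ q * y) ^ 2 ^ j)"
    by (simp add: freshmans_dream'[where 'a = 'a] CHAR_2 sum.distrib)
  finally show ?thesis by (simp only: distrib_right)
qed

text \<open>Orthogonality of characters of the additive group of \<open>K\<close>: either the
  character is trivial, or translation by an element of trace 1 negates the sum.\<close>

lemma sum_sign_trace:
  "(\<Sum>y\<in>K. bit_sign (abs_trace (2 * m) (x * y))) = (if x + x ^ q = 0 then int q else 0)"
proof (cases "x + x ^ q = 0")
  case True
  have "bit_sign (abs_trace (2 * m) (x * y)) = 1" if "y \<in> K" for y
  proof -
    have "(of_bit (abs_trace (2 * m) (x * y)) :: 'a) = 0"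
      unfolding trace_on_K[OF that] True by (simp add: power_0_left)
    thus ?thesis by (cases "abs_trace (2 * m) (x * y)") simp_all
  qed
  thus ?thesis using True by (simp add: card_K)
next
  case False
  obtain z where z: "z \<in> K" "(\<Sum>j<m. z ^ 2 ^ j) \<noteq> 0"
    using exists_trace_nonzero[OF m, of K] card_K q by auto
  \<comment> \<open>Chosen so that \<open>(x + x ^ q) * w = z\<close>, the element whose trace over
    the subfield is nonzero.\<close>
  define w where "w = z / (x + x ^ q)"
  have w: "w \<in> K" unfolding w_def by (intro K_divide z K_trace)
  have "(of_bit (abs_trace (2 * m) (x * w)) :: 'a) \<noteq> 0"
    unfolding trace_on_K[OF w] using z False by (simp add: w_def)
  hence tr: "abs_trace (2 * m) (x * w) = 1"
    by (cases "abs_trace (2 * m) (x * w)") simp_all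
  let ?S = "\<Sum>y\<in>K. bit_sign (abs_trace (2 * m) (x * y))"
  \<comment> \<open>Translation by \<open>w\<close> is its own inverse because
    \<open>w + w = 0\<close>.\<close>
  have "?S = (\<Sum>y\<in>K. bit_sign (abs_trace (2 * m) (x * (y + w))))"
    by (rule sum.reindex_bij_witness[of _ "\<lambda>y. y + w" "\<lambda>y. y + w"])
       (simp_all add: add.assoc K_add w)
  also have "\<dots> = - ?S"
    by (simp only: distrib_left abs_trace_add[OF card_2] bit_sign_add tr) (simp add: sum_negf)
  finally show ?thesis using False by simp
qed

section \<open>Walsh values as counts of indices\<close>

lemma conj_u_power: "(u ^ i) ^ q = u powi (- int i)"
  using u_powi_conj[of "int i"] by simp

text \<open>The set counted by \<open>N(b)\<close>; the right-hand side of the equation is the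
  relative trace of \<open>b * u ^ i\<close>.\<close>

definition walsh_index :: "(nat \<Rightarrow> 'a) \<Rightarrow> 'a \<Rightarrow> nat set" where
  "walsh_index \<alpha> b = {i. i \<le> q \<and> \<alpha> i = b * u ^ i + b ^ q * u powi (- int i)}"

text \<open>A ray without 0 contributes q - 1 or -1 according to whether its index is counted, and x
  = 0 contributes 1 once, so the total is qN - (q + 1) + 1.\<close>

lemma walsh_eq:
  assumes f0: "f 0 = 0"
    and f: "\<And>i y. i \<le> q \<Longrightarrow> y \<in> K - {0} \<Longrightarrow> f (u ^ i * y) = abs_trace (2 * m) (c i * y)"
  shows "walsh (2 * m) f b = int q * (int (card (walsh_index (\<lambda>i. c i + c i ^ q) b)) - 1)"
proof -
  let ?g = "\<lambda>x. bit_sign (f x + abs_trace (2 * m) (b * x))"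
  let ?N = "walsh_index (\<lambda>i. c i + c i ^ q) b"
  have inner: "(\<Sum>y\<in>K - {0}. ?g (u ^ i * y)) = (if i \<in> ?N then int q else 0) - 1"
    if i: "i \<in> {..q}" for i
  proof -
    define d where "d = c i + b * u ^ i"
    have "(\<Sum>y\<in>K - {0}. ?g (u ^ i * y)) = (\<Sum>y\<in>K - {0}. bit_sign (abs_trace (2 * m) (d * y)))"
      using i by (intro sum.cong) (simp_all add: f d_def distrib_right abs_trace_add[OF card_2] mult.assoc)
    \<comment> \<open>The term y = 0, of sign 1, is restored so that the sum runs over the whole
      group \<open>K\<close>.\<close>
    also have "\<dots> = (\<Sum>y\<in>K. bit_sign (abs_trace (2 * m) (d * y))) - 1"
      using K_0 by (subst sum_diff1) (simp_all add: abs_trace_0[OF card_2])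
    also have "\<dots> = (if d + d ^ q = 0 then int q else 0) - 1"
      by (simp only: sum_sign_trace)
    also have "d + d ^ q = (c i + c i ^ q) + (b * u ^ i + b ^ q * u powi (- int i))"
      by (simp add: d_def conj_add power_mult_distrib conj_u_power add_ac)
    also have "\<dots> = 0 \<longleftrightarrow> i \<in> ?N"
      using i by (simp add: walsh_index_def add_eq_0_iff_eq)
    finally show ?thesis .
  qed
  have "walsh (2 * m) f b = (\<Sum>x\<in>UNIV. ?g x)"
    by (simp only: walsh_def bit_sign_def)
  also have "\<dots> = 1 + (\<Sum>x\<in>UNIV - {0}. ?g x)"
    by (subst sum.remove[of _ 0]) (simp_all add: f0 abs_trace_0[OF card_2])
  also have "(\<Sum>x\<in>UNIV - {0}. ?g x) = (\<Sum>v\<in>{..q} \<times> (K - {0}). ?g (polar v))"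
    by (rule sum.reindex_bij_betw[OF polar_bij, symmetric])
  also have "\<dots> = (\<Sum>i\<in>{..q}. \<Sum>y\<in>K - {0}. ?g (u ^ i * y))"
    by (simp add: sum.cartesian_product polar_def case_prod_unfold)
  also have "\<dots> = (\<Sum>i\<in>{..q}. (if i \<in> ?N then int q else 0) - 1)"
    by (rule sum.cong[OF refl inner])
  also have "\<dots> = (\<Sum>i\<in>{..q}. if i \<in> ?N then int q else 0) - (int q + 1)"
    by (simp add: sum_subtractf)
  also have "(\<Sum>i\<in>{..q}. if i \<in> ?N then int q else 0) = (\<Sum>i\<in>?N. int q)"
    by (intro sum.mono_neutral_cong_right) (auto simp: walsh_index_def)
  finally show ?thesis by (simp add: algebra_simps)
qed

text \<open>As 2^(n/2) = q, the modulus condition reduces to |N(b) - 1| = 1.\<close>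

lemma bent_iff_card:
  assumes "f 0 = 0"
    and "\<And>i y. i \<le> q \<Longrightarrow> y \<in> K - {0} \<Longrightarrow> f (u ^ i * y) = abs_trace (2 * m) (c i * y)"
  shows "bent (2 * m) f \<longleftrightarrow> (\<forall>b. card (walsh_index (\<lambda>i. c i + c i ^ q) b) \<in> {0, 2})"
proof -
  have "\<bar>real_of_int (int q * (int k - 1))\<bar> = 2 powr (real (2 * m) / 2) \<longleftrightarrow> k \<in> {0, 2}" for k
  proof -
    have "2 powr (real (2 * m) / 2) = real q" by (simp add: q powr_realpow)
    moreover have "\<bar>real_of_int (int q * (int k - 1))\<bar> = real q * \<bar>real k - 1\<bar>"
      by (simp add: abs_mult)
    ultimately have "\<bar>real_of_int (int q * (int k - 1))\<bar> = 2 powr (real (2 * m) / 2)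
        \<longleftrightarrow> \<bar>real k - 1\<bar> = 1"
      using q_gt_1 by simp
    also have "\<dots> \<longleftrightarrow> k \<in> {0, 2}" by (auto simp: abs_if)
    finally show ?thesis .
  qed
  thus ?thesis by (simp only: bent_def walsh_eq[of f c, OF assms])
qed

section \<open>The lines u^(-t) K without 0, and the ratios on them\<close>

definition line :: "nat \<Rightarrow> 'a set" where
  "line t = {b. b \<noteq> 0 \<and> b * u ^ t \<in> K}"

text \<open>For \<open>i \<noteq> t\<close>, the only candidate on \<open>line t\<close> for solving
  the equation of index \<open>i\<close>. At \<open>i = t\<close> the denominator is 0 and division
  returns the default 0, so that index is always left out.\<close>

definition ratio :: "(nat \<Rightarrow> 'a) \<Rightarrow> nat \<Rightarrow> nat \<Rightarrow> 'a" where
  "ratio \<alpha> t i = \<alpha> i / (u ^ i + u powi (2 * int t - int i))"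

lemma card_line: "card (line t) = q - 1"
proof -
  have "bij_betw (\<lambda>b. b * u ^ t) (line t) (K - {0})"
    by (rule bij_betw_byWitness[where f' = "\<lambda>y. y / u ^ t"]) (auto simp: line_def u_nonzero)
  thus ?thesis using K_0 by (simp add: bij_betw_same_card card_Diff_singleton card_K)
qed

text \<open>The polar decomposition is applied to the inverse of \<open>b\<close>, so that
  \<open>t\<close> comes out in the range up to \<open>q\<close> without negating an index.\<close>

lemma ex_line:
  assumes "b \<noteq> 0"
  shows "\<exists>t\<le>q. b \<in> line t"
proof -
  have "inverse b \<in> polar ` ({..q} \<times> (K - {0}))"
    using polar_bij assms by (simp add: bij_betw_def)
  then obtain t y where t: "t \<le> q" "y \<in> K" "y \<noteq> 0" "inverse b = u ^ t * y"
    by (auto simp: polar_def)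
  have "b * u ^ t = 1 / y" using t(3,4) assms by (simp add: field_simps)
  moreover have "1 / y \<in> K" using t(2) by (intro K_divide) (simp_all add: in_K_iff)
  ultimately show ?thesis using t(1) assms by (auto simp: line_def)
qed

text \<open>The second factor is the relative trace of u^(i-t), hence lies in
  \<open>K\<close>.\<close>

lemma denominator_eq:
  "u ^ i + u powi (2 * int t - int i) = u ^ t * (u powi (int i - int t) + u powi (int t - int i))"
  using u_powi_add[of "int t" "int i - int t"] u_powi_add[of "int t" "int t - int i"]
  by (simp add: distrib_left)

lemma denominator_nonzero:
  assumes "i \<le> q" "t \<le> q" "i \<noteq> t"
  shows "u ^ i + u powi (2 * int t - int i) \<noteq> 0"
proof
  assume "u ^ i + u powi (2 * int t - int i) = 0"
  hence "u powi (int i - int t) = u powi (int t - int i)"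
    by (simp add: denominator_eq u_nonzero add_eq_0_iff_eq)
  hence "u powi (int i - int t) * u powi (int i - int t)
      = u powi (int t - int i) * u powi (int i - int t)" by simp
  also have "\<dots> = 1" by (simp flip: u_powi_add)
  finally have "u powi (2 * (int i - int t)) = 1" by (simp only: mult_2 u_powi_add)
  thus False using assms by (simp only: u_powi_double_eq_1_iff index_eq_iff)
qed

lemma ratio_in_line:
  assumes "i \<le> q" "t \<le> q" "i \<noteq> t" "\<alpha> i \<in> K" "\<alpha> i \<noteq> 0"
  shows "ratio \<alpha> t i \<in> line t"
proof -
  have "ratio \<alpha> t i * u ^ t = \<alpha> i / (u powi (int i - int t) + u powi (int t - int i))"
    by (simp add: ratio_def denominator_eq u_nonzero)
  moreover have "u powi (int i - int t) + u powi (int t - int i) \<in> K"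
    using K_trace[of "u powi (int i - int t)"] by (simp add: u_powi_conj)
  ultimately have "ratio \<alpha> t i * u ^ t \<in> K" using assms(4) by (simp add: K_divide)
  thus ?thesis using assms denominator_nonzero by (simp add: line_def ratio_def)
qed

text \<open>Since \<open>b * u ^ t\<close> is its own conjugate, b^q = b u^(2t); this removes the
  conjugate and makes the equation linear in \<open>b\<close>.\<close>

lemma line_conj:
  assumes "b \<in> line t"
  shows "b * u ^ i + b ^ q * u powi (- int i) = b * (u ^ i + u powi (2 * int t - int i))"
proof -
  have "b ^ q * u powi (- int t) = b * u ^ t"
    using assms by (simp add: line_def in_K_iff power_mult_distrib conj_u_power)
  hence "b ^ q * (u powi (- int t) * u powi (int t - int i)) = b * (u ^ t * u powi (int t - int i))"
    by (simp flip: mult.assoc)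
  hence "b ^ q * u powi (- int i) = b * u powi (2 * int t - int i)"
    using u_powi_add[of "- int t" "int t - int i"] u_powi_add[of "int t" "int t - int i"] by simp
  thus ?thesis by (simp add: distrib_left)
qed

section \<open>Fibres of the ratios and the conditions on them\<close>

context
  fixes \<alpha> :: "nat \<Rightarrow> 'a" and Z
  assumes \<alpha>_K: "\<And>i. i \<le> q \<Longrightarrow> \<alpha> i \<in> K"
    and Z: "Z = {i. i \<le> q \<and> \<alpha> i = 0}"
begin

text \<open>Indices in \<open>Z\<close> have ratio 0, which lies on no line; the index
  \<open>t\<close> is accounted for separately.\<close>

definition fibre :: "nat \<Rightarrow> 'a \<Rightarrow> nat set" where
  "fibre t b = {i \<in> {..q} - {t} - Z. ratio \<alpha> t i = b}"

lemma finite_fibre [simp]: "finite (fibre t b)"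
  by (simp add: fibre_def)

lemma walsh_index_0: "walsh_index \<alpha> 0 = Z"
  using q_gt_1 by (simp add: walsh_index_def Z power_0_left)

text \<open>At index \<open>t\<close> the coefficient of \<open>b\<close> vanishes, so this index is
  a solution for every point of the line or for none, according to whether
  \<open>\<alpha> t = 0\<close>. The other solutions form the fibre.\<close>

lemma card_walsh_index:
  assumes t: "t \<le> q" and b: "b \<in> line t"
  shows "card (walsh_index \<alpha> b) = card (fibre t b) + (if t \<in> Z then 1 else 0)"
proof -
  have b0: "b \<noteq> 0" using b by (simp add: line_def)
  have "i \<in> walsh_index \<alpha> b \<longleftrightarrow> i \<in> fibre t b \<union> (Z \<inter> {t})" if "i \<le> q" for i
  proof (cases "i = t")
    case True
    have "u ^ t + u powi (2 * int t - int t) = 0" by simp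
    hence "i \<in> walsh_index \<alpha> b \<longleftrightarrow> i \<in> Z"
      using True that by (simp add: walsh_index_def line_conj[OF b] Z)
    thus ?thesis using True by (simp add: fibre_def)
  next
    case False
    note nz = denominator_nonzero[OF that t False]
    have "i \<in> walsh_index \<alpha> b \<longleftrightarrow> ratio \<alpha> t i = b"
      using nz that by (simp add: walsh_index_def line_conj[OF b] ratio_def nonzero_divide_eq_eq)
    moreover have "i \<notin> Z" if "ratio \<alpha> t i = b"
      using that b0 by (auto simp: Z ratio_def)
    ultimately show ?thesis using False that by (auto simp: fibre_def)
  qed
  moreover have "walsh_index \<alpha> b \<subseteq> {..q}" "fibre t b \<union> (Z \<inter> {t}) \<subseteq> {..q}"
    using t by (auto simp: walsh_index_def fibre_def)
  ultimately have "walsh_index \<alpha> b = fibre t b \<union> (Z \<inter> {t})" by blast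
  moreover have "fibre t b \<inter> (Z \<inter> {t}) = {}" by (auto simp: fibre_def)
  moreover have "finite (Z \<inter> {t})" by simp
  moreover have "card (Z \<inter> {t}) = (if t \<in> Z then 1 else 0)" by simp
  ultimately show ?thesis by (simp only: card_Un_disjoint finite_fibre)
qed

text \<open>The value at 0 is governed by \<open>Z\<close>, and the lines with
  \<open>t \<le> q\<close> cover all nonzero \<open>b\<close>.\<close>

lemma all_walsh_index_iff:
  "(\<forall>b. card (walsh_index \<alpha> b) \<in> {0, 2}) \<longleftrightarrow>
     card Z \<in> {0, 2} \<and>
     (\<forall>t\<le>q. \<forall>b\<in>line t. card (fibre t b) + (if t \<in> Z then 1 else 0) \<in> {0, 2})"
proof -
  have "(\<forall>b. card (walsh_index \<alpha> b) \<in> {0, 2}) \<longleftrightarrow>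
      card (walsh_index \<alpha> 0) \<in> {0, 2} \<and> (\<forall>b. b \<noteq> 0 \<longrightarrow> card (walsh_index \<alpha> b) \<in> {0, 2})"
    by metis
  also have "(\<forall>b. b \<noteq> 0 \<longrightarrow> card (walsh_index \<alpha> b) \<in> {0, 2}) \<longleftrightarrow>
      (\<forall>t\<le>q. \<forall>b\<in>line t. card (walsh_index \<alpha> b) \<in> {0, 2})"
  proof (intro iffI allI impI ballI)
    fix b :: 'a assume *: "\<forall>t\<le>q. \<forall>b\<in>line t. card (walsh_index \<alpha> b) \<in> {0, 2}" "b \<noteq> 0"
    then obtain t where "t \<le> q" "b \<in> line t" using ex_line by blast
    thus "card (walsh_index \<alpha> b) \<in> {0, 2}" using * by blast
  next
    fix t b assume *: "\<forall>b. b \<noteq> 0 \<longrightarrow> card (walsh_index \<alpha> b) \<in> {0, 2}" "b \<in> line t"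
    hence "b \<noteq> 0" by (simp add: line_def)
    thus "card (walsh_index \<alpha> b) \<in> {0, 2}" using * by blast
  qed
  also have "\<dots> \<longleftrightarrow> (\<forall>t\<le>q. \<forall>b\<in>line t. card (fibre t b) + (if t \<in> Z then 1 else 0) \<in> {0, 2})"
    by (intro all_cong ball_cong refl) (simp only: card_walsh_index)
  finally show ?thesis by (simp only: walsh_index_0)
qed

lemma ratio_image: "t \<le> q \<Longrightarrow> ratio \<alpha> t ` ({..q} - {t} - Z) \<subseteq> line t"
  using ratio_in_line \<alpha>_K by (auto simp: Z)

text \<open>A fibre is empty exactly off the image of the ratio map, and this image stays on the
  line; so size 0 needs no condition.\<close>

lemma fibres_outside_Z_iff:
  assumes t: "t \<le> q"
  shows "(\<forall>b\<in>line t. card (fibre t b) \<in> {0, 2}) \<longleftrightarrow>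
    (\<forall>b\<in>ratio \<alpha> t ` ({..q} - {t} - Z). card (fibre t b) = 2)"
proof -
  have "card (fibre t b) = 0 \<longleftrightarrow> b \<notin> ratio \<alpha> t ` ({..q} - {t} - Z)" for b
    by (simp add: card_eq_0_iff) (auto simp: fibre_def)
  thus ?thesis using ratio_image[OF t] by blast
qed

text \<open>The \<open>q - 1\<close> ratios lie on a line with \<open>q - 1\<close> points, so they are distinct iff they exhaust it.\<close>
lemma fibres_in_Z_iff:
  assumes t: "t \<in> Z" and Z2: "card Z = 2"
  shows "(\<forall>b\<in>line t. Suc (card (fibre t b)) \<in> {0, 2}) \<longleftrightarrow> inj_on (ratio \<alpha> t) ({..q} - Z)"
proof -
  have tq: "t \<le> q" using t by (simp add: Z)
  have S: "{..q} - {t} - Z = {..q} - Z" using t by auto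
  have sub: "ratio \<alpha> t ` ({..q} - Z) \<subseteq> line t" using ratio_image[OF tq] S by simp
  have "Z \<subseteq> {..q}" by (auto simp: Z)
  hence cS: "card ({..q} - Z) = q - 1" by (simp add: card_Diff_subset finite_subset Z2)
  show ?thesis
  proof
    assume *: "\<forall>b\<in>line t. Suc (card (fibre t b)) \<in> {0, 2}"
    show "inj_on (ratio \<alpha> t) ({..q} - Z)"
    proof (rule inj_onI)
      fix i j assume ij: "i \<in> {..q} - Z" "j \<in> {..q} - Z" "ratio \<alpha> t i = ratio \<alpha> t j"
      hence "ratio \<alpha> t i \<in> line t" using sub by blast
      hence "card (fibre t (ratio \<alpha> t i)) = 1" using * by auto
      moreover have "i \<in> fibre t (ratio \<alpha> t i)" "j \<in> fibre t (ratio \<alpha> t i)"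
        unfolding fibre_def S using ij by auto
      ultimately show "i = j" by (metis card_1_singletonE singletonD)
    qed
  next
    assume inj: "inj_on (ratio \<alpha> t) ({..q} - Z)"
    have "ratio \<alpha> t ` ({..q} - Z) = line t"
      by (intro card_subset_eq sub) (simp_all add: card_image[OF inj] cS card_line)
    moreover have "fibre t (ratio \<alpha> t i) = {i}" if "i \<in> {..q} - Z" for i
      unfolding fibre_def S using that inj by (auto dest: inj_onD)
    ultimately have "card (fibre t b) = 1" if "b \<in> line t" for b
      using that by (metis imageE card_1_singleton_iff One_nat_def)
    thus "\<forall>b\<in>line t. Suc (card (fibre t b)) \<in> {0, 2}" by simp
  qed
qed

text \<open>For \<open>t\<close> in \<open>Z\<close> the index \<open>t\<close> already counts once,
  so every fibre must be a singleton; for the other \<open>t\<close> the fibre alone must have size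
  0 or 2.\<close>

lemma all_walsh_index_iff_fibres:
  "(\<forall>b. card (walsh_index \<alpha> b) \<in> {0, 2}) \<longleftrightarrow>
     (Z = {} \<or> card Z = 2) \<and>
     (\<forall>t\<in>Z. inj_on (ratio \<alpha> t) ({..q} - Z)) \<and>
     (\<forall>t\<in>{..q} - Z. \<forall>b\<in>ratio \<alpha> t ` ({..q} - {t} - Z). card (fibre t b) = 2)"
proof -
  have Zq: "Z \<subseteq> {..q}" by (auto simp: Z)
  hence "finite Z" by (simp add: finite_subset)
  hence card_Z: "card Z \<in> {0, 2} \<longleftrightarrow> Z = {} \<or> card Z = 2" by simp
  have split: "(\<forall>t\<le>q. \<forall>b\<in>line t. card (fibre t b) + (if t \<in> Z then 1 else 0) \<in> {0, 2}) \<longleftrightarrow>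
      (\<forall>t\<in>Z. \<forall>b\<in>line t. Suc (card (fibre t b)) \<in> {0, 2}) \<and>
      (\<forall>t\<in>{..q} - Z. \<forall>b\<in>line t. card (fibre t b) \<in> {0, 2})"
  proof -
    have *: "(\<forall>t\<le>q. Q t) \<longleftrightarrow> (\<forall>t\<in>Z. Q t) \<and> (\<forall>t\<in>{..q} - Z. Q t)" for Q
      using Zq by blast
    show ?thesis
      unfolding * by (intro arg_cong2[where f = "(\<and>)"] ball_cong refl) simp_all
  qed
  have outside: "(\<forall>t\<in>{..q} - Z. \<forall>b\<in>line t. card (fibre t b) \<in> {0, 2}) \<longleftrightarrow>
      (\<forall>t\<in>{..q} - Z. \<forall>b\<in>ratio \<alpha> t ` ({..q} - {t} - Z). card (fibre t b) = 2)"
    by (intro ball_cong refl fibres_outside_Z_iff) simp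
  have inside: "(\<forall>t\<in>Z. \<forall>b\<in>line t. Suc (card (fibre t b)) \<in> {0, 2}) \<longleftrightarrow>
      (\<forall>t\<in>Z. inj_on (ratio \<alpha> t) ({..q} - Z))" if "Z = {} \<or> card Z = 2"
    using that by (elim disjE) (simp, intro ball_cong refl fibres_in_Z_iff)
  show ?thesis
    \<comment> \<open>The congruence rule supplies the condition on \<open>Z\<close> as a premise
      for rewriting the remaining conjuncts, as \<open>inside\<close> requires.\<close>
    unfolding all_walsh_index_iff card_Z split outside by (rule conj_cong[OF refl]) (simp only: inside)
qed

lemma all_walsh_index_iff_msets:
  "(\<forall>b. card (walsh_index \<alpha> b) \<in> {0, 2}) \<longleftrightarrow>
     (Z = {} \<or> card Z = 2) \<and>
     (\<forall>t\<in>Z. inj_on (ratio \<alpha> t) ({..q} - Z)) \<and>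
     (\<forall>t\<in>{..q} - Z.
        let M = image_mset (ratio \<alpha> t) (mset_set ({..q} - {t} - Z)) in \<forall>z\<in>#M. count M z = 2)"
  unfolding all_walsh_index_iff_fibres Let_def fibre_def
  by (subst image_mset_count_iff) simp_all

end

section \<open>Power maps on rays and the final equivalence\<close>

lemma polar_power:
  assumes "y \<in> K" "y \<noteq> 0"
  shows "(u ^ i * y) ^ (k * (q - 1) + 1) = u powi ((1 - 2 * int k) * int i) * y"
proof -
  \<comment> \<open>The power map acts on \<open>y\<close> as the identity, which is what makes
    \<open>f\<close> linear along each ray.\<close>
  have "y ^ Suc (q - 1) = y" using assms(1) q_gt_1 by (simp add: in_K_iff)
  hence "y ^ (q - 1) = 1" using assms(2) by simp
  hence "y ^ (k * (q - 1) + 1) = y" by (simp add: power_mult mult.commute[of k])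
  moreover have "(u ^ i) ^ (k * (q - 1) + 1) = u powi ((1 - 2 * int k) * int i)"
  proof -
    have "(u ^ i) ^ (k * (q - 1) + 1) = u powi (int i * (int k * (int q - 1) + 1))"
    proof -
      have "(u ^ i) ^ (k * (q - 1) + 1) = u powi int (i * (k * (q - 1) + 1))"
        by (simp only: power_mult power_int_of_nat)
      also have "int (i * (k * (q - 1) + 1)) = int i * (int k * (int q - 1) + 1)"
        using q_gt_1 by (simp add: of_nat_diff distrib_left)
      finally show ?thesis .
    qed
    \<comment> \<open>Modulo q + 1 the factor q - 1 is -2, so k(q - 1) + 1 may be replaced by 1 -
      2k.\<close>
    also have "int i * (int k * (int q - 1) + 1) - (1 - 2 * int k) * int i
        = int (q + 1) * (int i * int k)"
      by (simp add: algebra_simps)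
    hence "u powi (int i * (int k * (int q - 1) + 1)) = u powi ((1 - 2 * int k) * int i)"
      by (intro u_powi_eqI) (simp only: dvd_triv_left)
    finally show ?thesis .
  qed
  ultimately show ?thesis by (simp only: power_mult_distrib)
qed

end

theorem theorem3p8:
  fixes m n q :: nat
    and \<omega> u :: "'a :: finite_field"
    and a \<alpha> :: "nat \<Rightarrow> 'a"
    and s :: "nat \<Rightarrow> nat"
    and f :: "'a \<Rightarrow> bit"
  assumes m: "m \<ge> 1" and n: "n = 2 * m" and q: "q = 2 ^ m"
    and card: "CARD('a) = q ^ 2"
    and \<omega>: "primitive_element \<omega>"
    and u: "u = \<omega> ^ ((q - 1) * (2 ^ (n - 1) - 1))"
    and s: "\<And>i. i \<le> q \<Longrightarrow> s i \<le> q"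
    and \<alpha>: "\<And>i. i \<le> q \<Longrightarrow>
              \<alpha> i = a i * u powi ((1 - 2 * int (s i)) * int i)
                   + a i ^ q * u powi ((2 * int (s i) - 1) * int i)"
    and f0: "f 0 = 0"
    and f: "\<And>i x. i \<le> q \<Longrightarrow> x \<in> (\<lambda>y. u ^ i * y) ` (subfield_of_order q - {0}) \<Longrightarrow>
              f x = abs_trace n (a i * x ^ (s i * (q - 1) + 1))"
  shows "bent n f \<longleftrightarrow>
    ((\<forall>i\<le>q. \<alpha> i \<noteq> 0) \<and>
     (\<forall>t\<le>q. let M = {# \<alpha> i / (u ^ i + u powi (2 * int t - int i)). i \<in># mset_set ({..q} - {t}) #}
             in \<forall>z\<in>#M. count M z = 2))
    \<or>
    (\<exists>i1\<le>q. \<exists>i2\<le>q. i1 \<noteq> i2 \<and> \<alpha> i1 = 0 \<and> \<alpha> i2 = 0 \<and>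
       (\<forall>i\<in>{..q} - {i1, i2}. \<alpha> i \<noteq> 0) \<and>
       (\<forall>t\<in>{i1, i2}.
          inj_on (\<lambda>i. \<alpha> i / (u ^ i + u powi (2 * int t - int i))) ({..q} - {i1, i2})) \<and>
       (\<forall>t\<in>{..q} - {i1, i2}.
          let M = {# \<alpha> i / (u ^ i + u powi (2 * int t - int i)). i \<in># mset_set ({..q} - {t, i1, i2}) #}
          in \<forall>z\<in>#M. count M z = 2))"
proof -
  interpret even_degree_field m q \<omega> u
    using m q card \<omega> u unfolding n by unfold_locales
  define c where "c i = a i * u powi ((1 - 2 * int (s i)) * int i)" for i
  define Z where "Z = {i. i \<le> q \<and> \<alpha> i = 0}"
  have \<alpha>_c: "\<alpha> i = c i + c i ^ q" if "i \<le> q" for i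
  proof -
    \<comment> \<open>Conjugating \<open>c i\<close> negates the exponent of \<open>u\<close>, which
      matches the second summand of \<open>\<alpha> i\<close>.\<close>
    have "- ((1 - 2 * int (s i)) * int i) = (2 * int (s i) - 1) * int i"
      by (simp add: algebra_simps)
    thus ?thesis using \<alpha>[OF that] by (simp only: c_def power_mult_distrib u_powi_conj)
  qed
  have f_polar: "f (u ^ i * y) = abs_trace (2 * m) (c i * y)" if "i \<le> q" "y \<in> K - {0}" for i y
  proof -
    have "y \<in> K" "y \<noteq> 0" using that(2) by auto
    note f[OF that(1) imageI[OF that(2)], unfolded polar_power[OF this]]
    thus ?thesis by (simp only: n c_def mult.assoc)
  qed
  \<comment> \<open>Only indices up to \<open>q\<close> are inspected; beyond them
    \<open>\<alpha>\<close> and the relative trace of \<open>c\<close> need not agree.\<close>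
  have "walsh_index (\<lambda>i. c i + c i ^ q) = walsh_index \<alpha>"
    by (intro ext Collect_cong conj_cong refl) (auto simp: walsh_index_def \<alpha>_c)
  hence "bent n f \<longleftrightarrow> (\<forall>b. card (walsh_index \<alpha> b) \<in> {0, 2})"
    using bent_iff_card[of f c, OF f0 f_polar] by (simp only: n)
  also have "\<dots> \<longleftrightarrow> (Z = {} \<or> card Z = 2) \<and>
     (\<forall>t\<in>Z. inj_on (ratio \<alpha> t) ({..q} - Z)) \<and>
     (\<forall>t\<in>{..q} - Z.
        let M = image_mset (ratio \<alpha> t) (mset_set ({..q} - {t} - Z)) in \<forall>z\<in>#M. count M z = 2)"
    by (rule all_walsh_index_iff_msets) (simp_all add: Z_def \<alpha>_c K_trace)
  also have "\<dots> \<longleftrightarrow> (Z = {} \<and> (\<forall>t\<le>q.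
        let M = image_mset (ratio \<alpha> t) (mset_set ({..q} - {t})) in \<forall>z\<in>#M. count M z = 2)) \<or>
     (\<exists>i1 i2. Z = {i1, i2} \<and> i1 \<noteq> i2 \<and>
       (\<forall>t\<in>{i1, i2}. inj_on (ratio \<alpha> t) ({..q} - {i1, i2})) \<and>
       (\<forall>t\<in>{..q} - {i1, i2}.
          let M = image_mset (ratio \<alpha> t) (mset_set ({..q} - {t, i1, i2})) in \<forall>z\<in>#M. count M z = 2))"
    (is "?lhs \<longleftrightarrow> ?rhs")
  proof -
    have diff: "{..q} - {t} - {i1, i2} = {..q} - {t, i1, i2}" for t i1 i2 by blast
    show ?thesis
    proof
      assume ?lhs
      hence "Z = {} \<or> (\<exists>i1 i2. Z = {i1, i2} \<and> i1 \<noteq> i2)" by (simp only: card_2_iff)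
      thus ?rhs
      proof (elim disjE exE conjE)
        assume "Z = {}"
        thus ?rhs using \<open>?lhs\<close> by simp
      next
        fix i1 i2 assume Z2: "Z = {i1, i2}" "i1 \<noteq> i2"
        show ?rhs using \<open>?lhs\<close> unfolding Z2(1) diff using Z2(2) by blast
      qed
    next
      assume ?rhs
      thus ?lhs
      proof (elim disjE exE conjE)
        assume "Z = {}" "\<forall>t\<le>q.
          let M = image_mset (ratio \<alpha> t) (mset_set ({..q} - {t})) in \<forall>z\<in>#M. count M z = 2"
        thus ?lhs by simp
      next
        fix i1 i2 assume Z2: "Z = {i1, i2}" "i1 \<noteq> i2"
          and "\<forall>t\<in>{i1, i2}. inj_on (ratio \<alpha> t) ({..q} - {i1, i2})"
          and "\<forall>t\<in>{..q} - {i1, i2}.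
            let M = image_mset (ratio \<alpha> t) (mset_set ({..q} - {t, i1, i2})) in \<forall>z\<in>#M. count M z = 2"
        moreover have "card {i1, i2} = 2" using Z2(2) by simp
        ultimately show ?lhs unfolding Z2(1) diff by blast
      qed
    qed
  qed
  finally have bent_Z: "bent n f \<longleftrightarrow> ?rhs" .
  have Z_empty: "Z = {} \<longleftrightarrow> (\<forall>i\<le>q. \<alpha> i \<noteq> 0)" by (auto simp: Z_def)
  have Z_pair: "Z = {i1, i2} \<longleftrightarrow>
      i1 \<le> q \<and> i2 \<le> q \<and> \<alpha> i1 = 0 \<and> \<alpha> i2 = 0 \<and> (\<forall>i\<in>{..q} - {i1, i2}. \<alpha> i \<noteq> 0)"
    for i1 i2 by (auto simp: Z_def)
  \<comment> \<open>Pure logic: the range conditions from \<open>Z_pair\<close> move into bounded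
    quantifiers, to match the shape of the claim.\<close>
  have reorder: "(\<exists>i1 i2. (i1 \<le> q \<and> i2 \<le> q \<and> \<alpha> i1 = 0 \<and> \<alpha> i2 = 0 \<and> N i1 i2) \<and> i1 \<noteq> i2 \<and> A i1 i2 \<and> B i1 i2)
      \<longleftrightarrow> (\<exists>i1\<le>q. \<exists>i2\<le>q. i1 \<noteq> i2 \<and> \<alpha> i1 = 0 \<and> \<alpha> i2 = 0 \<and> N i1 i2 \<and> A i1 i2 \<and> B i1 i2)"
    for N A B :: "nat \<Rightarrow> nat \<Rightarrow> bool"
    by blast
  show ?thesis
    unfolding bent_Z Z_empty Z_pair reorder ratio_def[abs_def] ..
qed

end
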